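(* Let $n$ be a non-negative integer and $\mu\in\mathbb{C}$. For either choice of sign $\pm$, for $z\in(1,\infty)$ and $\xi\in(0,\infty)$, $$P^\mu_{-\frac12\pm(n+\frac12)}(z)=\frac{n!}{\Gamma(n-\mu+1)}\left(\frac{z+1}{z-1}\right)^{\mu/2}P_n^{(-\mu,\mu)}(z),$$ $$P^\mu_{-\frac12\pm(n+\frac12)}(\cosh\xi)=\frac{n!}{\Gamma(n-\mu+1)}\,[\coth(\xi/2)]^\mu\,P_n^{(-\mu,\mu)}(\cosh\xi),$$ where $P_\nu^\mu$ is the associated Legendre function of the first kind and $P_n^{(\alpha,\beta)}$ is the Jacobi polynomial. (In the degenerate case when $\mu-n$ is a positive integer, $P^\mu_{-\frac12\pm(n+\frac12)}\equiv0$.)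
   Context: For $z>1$, $P_\nu^\mu(z)=\frac1{\Gamma(1-\mu)}\left(\frac{z+1}{z-1}\right)^{\mu/2}{}_2F_1\!\left(-\nu,\nu+1;1-\mu;\frac{1-z}2\right)$, with ${}_2F_1$ the (analytically continued) Gauss function, a limit being taken when $\mu$ is a positive integer. The Jacobi polynomials, for arbitrary complex $\alpha,\beta$, are given by the Rodrigues formula $$P_n^{(\alpha,\beta)}(z)=\frac{(-1)^n}{2^nn!}(1-z)^{-\alpha}(1+z)^{-\beta}\frac{{\rm d}^n}{{\rm d}z^n}\left[(1-z)^{\alpha+n}(1+z)^{\beta+n}\right],$$ equivalently $P_n^{(\alpha,\beta)}(z)=\frac{(\alpha+1)_n}{n!}\,{}_2F_1\!\left(-n,n+\alpha+\beta+1;\alpha+1;\frac{1-z}2\right)$ (understood as a limit if $\alpha$ is a negative integer). *)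

theory Defs
  imports "HOL-Complex_Analysis.Complex_Analysis"
begin

definition slit_plane :: "complex set" where
  "slit_plane = - {z. Im z = 0 \<and> 1 \<le> Re z}"

(* Principal branch of the Gauss function: the holomorphic function on the plane cut along
   [1, infinity) that agrees with the hypergeometric series on the unit disc.  The value is
   meaningful only for x in slit_plane and c not in {0, -1, -2, ...}. *)
definition hyp2F1 :: "complex \<Rightarrow> complex \<Rightarrow> complex \<Rightarrow> complex \<Rightarrow> complex" where
  "hyp2F1 a b c x =
     (SOME f. f holomorphic_on slit_plane \<and>
        (\<forall>w\<in>ball 0 1. f w = eval_fps (fps_hypergeo [a, b] [c] 1) w)) x"

definition legendre_P_generic :: "complex \<Rightarrow> complex \<Rightarrow> real \<Rightarrow> complex" where
  "legendre_P_generic \<nu> \<mu> z =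
     1 / Gamma (1 - \<mu>) * of_real ((z + 1) / (z - 1)) powr (\<mu> / 2) *
       hyp2F1 (- \<nu>) (\<nu> + 1) (1 - \<mu>) (of_real ((1 - z) / 2))"

(* Associated Legendre function of the first kind on (1, infinity); when \<mu> is a positive integer,
   1 - \<mu> is a pole of Gamma and the defining expression is replaced by its limit in \<mu>. *)
definition legendre_P :: "complex \<Rightarrow> complex \<Rightarrow> real \<Rightarrow> complex" where
  "legendre_P \<nu> \<mu> z =
     (if \<exists>m::nat. m \<ge> 1 \<and> \<mu> = of_nat m
      then Lim (at \<mu>) (\<lambda>\<kappa>. legendre_P_generic \<nu> \<kappa> z)
      else legendre_P_generic \<nu> \<mu> z)"

definition rodrigues :: "nat \<Rightarrow> complex \<Rightarrow> complex \<Rightarrow> complex \<Rightarrow> complex" where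
  "rodrigues n \<alpha> \<beta> z =
     (-1) ^ n / (2 ^ n * fact n) * (1 - z) powr (- \<alpha>) * (1 + z) powr (- \<beta>) *
       (deriv ^^ n) (\<lambda>w. (1 - w) powr (\<alpha> + of_nat n) * (1 + w) powr (\<beta> + of_nat n)) z"

definition doubly_cut_plane :: "complex set" where
  "doubly_cut_plane = - {z. Im z = 0 \<and> 1 \<le> \<bar>Re z\<bar>}"

(* With principal powers the Rodrigues expression is analytic off the cuts (-infinity, -1] and
   [1, infinity), where it coincides with a unique polynomial (see jacobi_rodrigues below);
   that polynomial gives the value at every z, including the points z > 1 on the cut. *)
definition jacobi_poly :: "nat \<Rightarrow> complex \<Rightarrow> complex \<Rightarrow> complex poly" where
  "jacobi_poly n \<alpha> \<beta> =
     (THE p. \<forall>z\<in>doubly_cut_plane. poly p z = rodrigues n \<alpha> \<beta> z)"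

definition jacobi :: "nat \<Rightarrow> complex \<Rightarrow> complex \<Rightarrow> complex \<Rightarrow> complex" where
  "jacobi n \<alpha> \<beta> z = poly (jacobi_poly n \<alpha> \<beta>) z"

definition coth :: "real \<Rightarrow> real" where
  "coth x = cosh x / sinh x"

lemma open_slit_plane: "open slit_plane"
proof -
  have "{z. Im z = 0 \<and> 1 \<le> Re z} = {z. Im z = 0} \<inter> {z. Re z \<ge> 1}" by auto
  hence "closed {z. Im z = 0 \<and> 1 \<le> Re z}"
    using closed_Int[OF closed_halfspace_Im_eq closed_halfspace_Re_ge] by simp
  thus ?thesis unfolding slit_plane_def by (rule open_Compl)
qed

lemma connected_slit_plane: "connected slit_plane"
proof -
  have "starlike slit_plane"
    unfolding starlike_def
  proof (intro bexI[of _ 0] ballI subsetI)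
    show "0 \<in> slit_plane" by (simp add: slit_plane_def)
    fix x y assume x: "x \<in> slit_plane" and "y \<in> closed_segment 0 x"
    then obtain u where u: "0 \<le> u" "u \<le> 1" "y = u *\<^sub>R x"
      by (auto simp: closed_segment_def)
    show "y \<in> slit_plane"
    proof (rule ccontr)
      assume "y \<notin> slit_plane"
      hence y: "u * Im x = 0" "1 \<le> u * Re x" using u by (auto simp: slit_plane_def)
      hence "u \<noteq> 0" by auto
      with y u have "Im x = 0" "u > 0" by auto
      moreover have "Re x > 0" using y u by (smt (verit) mult_nonneg_nonpos)
      hence "u * Re x \<le> Re x" using u by simp
      ultimately show False using x y by (auto simp: slit_plane_def)
    qed
  qed
  thus ?thesis by (rule starlike_imp_connected)
qed

lemma hyp2F1_unique:
  assumes "f holomorphic_on slit_plane"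
    and "\<And>w. w \<in> ball 0 1 \<Longrightarrow> f w = eval_fps (fps_hypergeo [a, b] [c] 1) w"
    and "x \<in> slit_plane"
  shows "hyp2F1 a b c x = f x"
proof -
  let ?P = "\<lambda>f. f holomorphic_on slit_plane \<and>
        (\<forall>w\<in>ball 0 1. f w = eval_fps (fps_hypergeo [a, b] [c] 1) w)"
  define g where "g = (SOME f. ?P f)"
  have "?P f" using assms by auto
  hence g: "?P g" unfolding g_def by (rule someI[where P = ?P])
  have sub: "ball 0 1 \<subseteq> slit_plane"
  proof
    fix w :: complex assume "w \<in> ball 0 1"
    hence "Re w < 1" using complex_Re_le_cmod[of w] by simp
    thus "w \<in> slit_plane" by (simp add: slit_plane_def)
  qed
  have "g x = f x"
    by (rule analytic_continuation_open[of "ball 0 1" slit_plane g f x])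
       (use g assms sub in \<open>auto simp: open_slit_plane connected_slit_plane\<close>)
  thus ?thesis by (simp add: hyp2F1_def g_def)
qed

lemma open_doubly_cut_plane: "open doubly_cut_plane"
proof -
  have "{z. Im z = 0 \<and> 1 \<le> \<bar>Re z\<bar>} = {z. Im z = 0} \<inter> ({z. Re z \<ge> 1} \<union> {z. Re z \<le> -1})"
    by auto
  hence "closed {z. Im z = 0 \<and> 1 \<le> \<bar>Re z\<bar>}"
    using closed_Int[OF closed_halfspace_Im_eq
        closed_Un[OF closed_halfspace_Re_ge closed_halfspace_Re_le]] by simp
  thus ?thesis unfolding doubly_cut_plane_def by (rule open_Compl)
qed

lemma doubly_cut_planeD:
  assumes "z \<in> doubly_cut_plane"
  shows "1 - z \<notin> \<real>\<^sub>\<le>\<^sub>0" "1 + z \<notin> \<real>\<^sub>\<le>\<^sub>0" "1 - z \<noteq> 0" "1 + z \<noteq> 0"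
proof -
  show *: "1 - z \<notin> \<real>\<^sub>\<le>\<^sub>0" "1 + z \<notin> \<real>\<^sub>\<le>\<^sub>0"
    using assms by (auto simp: doubly_cut_plane_def complex_nonpos_Reals_iff)
  show "1 - z \<noteq> 0" "1 + z \<noteq> 0" using * by force+
qed

lemma higher_deriv_jacobi_weight:
  "\<exists>q. \<forall>z\<in>doubly_cut_plane.
     (deriv ^^ k) (\<lambda>w. (1 - w) powr a * (1 + w) powr b) z =
       (1 - z) powr (a - of_nat k) * (1 + z) powr (b - of_nat k) * poly q z"
proof (induction k)
  case 0
  show ?case by (rule exI[of _ 1]) auto
next
  case (Suc k)
  then obtain q where q: "\<And>z. z \<in> doubly_cut_plane \<Longrightarrow>
     (deriv ^^ k) (\<lambda>w. (1 - w) powr a * (1 + w) powr b) z =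
       (1 - z) powr (a - of_nat k) * (1 + z) powr (b - of_nat k) * poly q z" by blast
  define c d where "c = a - of_nat k" and "d = b - of_nat k"
  define r where "r = [:1, 0, -1:] * pderiv q + (smult d [:1, -1:] - smult c [:1, 1:]) * q"
  show ?case
  proof (intro exI[of _ r] ballI)
    fix z assume z: "z \<in> doubly_cut_plane"
    note nz = doubly_cut_planeD[OF z]
    have "(deriv ^^ Suc k) (\<lambda>w. (1 - w) powr a * (1 + w) powr b) z =
        deriv ((deriv ^^ k) (\<lambda>w. (1 - w) powr a * (1 + w) powr b)) z" by simp
    also have "\<dots> = deriv (\<lambda>z. (1 - z) powr c * (1 + z) powr d * poly q z) z"
      by (rule deriv_cong_ev)
         (use q z open_doubly_cut_plane eventually_nhds_in_open[of doubly_cut_plane z] in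
           \<open>auto elim!: eventually_mono simp: c_def d_def\<close>)
    also have "\<dots> = (1 - z) powr (c - 1) * (1 + z) powr (d - 1) * poly r z"
    proof (rule DERIV_imp_deriv)
      have e: "(1 - z) powr c = (1 - z) * (1 - z) powr (c - 1)"
              "(1 + z) powr d = (1 + z) * (1 + z) powr (d - 1)"
        using nz by (simp_all add: powr_diff)
      show "((\<lambda>z. (1 - z) powr c * (1 + z) powr d * poly q z) has_field_derivative
              (1 - z) powr (c - 1) * (1 + z) powr (d - 1) * poly r z) (at z)"
        by (rule derivative_eq_intros poly_DERIV refl nz | simp)+
           (unfold e r_def, simp add: algebra_simps)
    qed
    finally show "(deriv ^^ Suc k) (\<lambda>w. (1 - w) powr a * (1 + w) powr b) z =
        (1 - z) powr (a - of_nat (Suc k)) * (1 + z) powr (b - of_nat (Suc k)) * poly r z"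
      by (simp add: c_def d_def algebra_simps)
  qed
qed

lemma jacobi_rodrigues:
  assumes "z \<in> doubly_cut_plane"
  shows "jacobi n \<alpha> \<beta> z = rodrigues n \<alpha> \<beta> z"
proof -
  obtain q where q: "\<And>z. z \<in> doubly_cut_plane \<Longrightarrow>
     (deriv ^^ n) (\<lambda>w. (1 - w) powr (\<alpha> + of_nat n) * (1 + w) powr (\<beta> + of_nat n)) z =
       (1 - z) powr \<alpha> * (1 + z) powr \<beta> * poly q z"
    using higher_deriv_jacobi_weight[of n "\<alpha> + of_nat n" "\<beta> + of_nat n"] by auto
  define p where "p = smult ((-1) ^ n / (2 ^ n * fact n)) q"
  have p: "poly p z = rodrigues n \<alpha> \<beta> z" if "z \<in> doubly_cut_plane" for z
    using doubly_cut_planeD[OF that] q[OF that]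
    by (simp add: p_def rodrigues_def powr_minus field_simps)
  have sub: "complex_of_real ` {0<..<1} \<subseteq> doubly_cut_plane"
    by (auto simp: doubly_cut_plane_def)
  have inf: "infinite doubly_cut_plane"
  proof
    assume "finite doubly_cut_plane"
    hence "finite (complex_of_real ` {0<..<1})" using sub by (rule finite_subset[rotated])
    hence "finite {0<..<1::real}" by (rule finite_imageD) (auto simp: inj_on_def)
    thus False using infinite_Ioo[of 0 "1::real"] by simp
  qed
  have "\<forall>z\<in>doubly_cut_plane. poly (jacobi_poly n \<alpha> \<beta>) z = rodrigues n \<alpha> \<beta> z"
    unfolding jacobi_poly_def
  proof (rule theI[of _ p])
    show "\<forall>z\<in>doubly_cut_plane. poly p z = rodrigues n \<alpha> \<beta> z" using p by blast
    fix p' assume p': "\<forall>z\<in>doubly_cut_plane. poly p' z = rodrigues n \<alpha> \<beta> z"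
    hence "doubly_cut_plane \<subseteq> {z. poly (p' - p) z = 0}" using p by auto
    hence "infinite {z. poly (p' - p) z = 0}" using inf finite_subset by blast
    thus "p' = p" using poly_roots_finite[of "p' - p"] by auto
  qed
  thus ?thesis using assms by (simp add: jacobi_def)
qed

end

theory Submission
  imports Defs
begin

text \<open>
  Both sides are, up to the factor ((z + 1)/(z - 1)) powr (\<mu>/2), polynomials in (z - 1)/2 whose
  coefficients are entire in \<mu>. For the Legendre function the Gauss series terminates, and
  1/(Gamma (1 - \<mu>) (1 - \<mu>)_k) = rGamma (1 - \<mu> + k) removes the singularities at positive
  integers \<mu>, so the limit there is taken by continuity. For the Jacobi polynomial the Leibniz
  rule applied to the Rodrigues formula gives a sum in powers of (z - 1)/2 and (z + 1)/2;
  expanding the latter around z = 1 and using Vandermonde's identity gives its coefficients.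
\<close>

section \<open>Jacobi polynomials: from the Rodrigues formula to powers of (z - 1)/2\<close>

lemma higher_deriv_powr_affine:
  fixes a s z :: complex
  assumes "1 + s * z \<notin> \<real>\<^sub>\<le>\<^sub>0"
  shows "(deriv ^^ k) (\<lambda>w. (1 + s * w) powr a) z =
    s ^ k * fact k * (a gchoose k) * (1 + s * z) powr (a - of_nat k)"
  using assms
proof (induction k arbitrary: z)
  case 0
  thus ?case by simp
next
  case (Suc k)
  \<comment> \<open>The induction hypothesis holds throughout this open set, so it is an identity
    near \<open>z\<close> and may be differentiated.\<close>
  define S where "S = {w. 1 + s * w \<notin> \<real>\<^sub>\<le>\<^sub>0}"
  have "open ((\<lambda>w. 1 + s * w) -` (- \<real>\<^sub>\<le>\<^sub>0))"
    by (intro continuous_open_vimage continuous_intros open_Compl closed_nonpos_Reals_complex)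
  hence "open S" by (simp add: S_def vimage_def)
  have "(deriv ^^ Suc k) (\<lambda>w. (1 + s * w) powr a) z =
      deriv ((deriv ^^ k) (\<lambda>w. (1 + s * w) powr a)) z" by simp
  also have "\<dots> = deriv (\<lambda>w. s ^ k * fact k * (a gchoose k) * (1 + s * w) powr (a - of_nat k)) z"
    by (rule deriv_cong_ev)
       (use Suc \<open>open S\<close> eventually_nhds_in_open[of S z] in
          \<open>auto elim!: eventually_mono simp: S_def\<close>)
  also have "\<dots> = s ^ k * fact k * (a gchoose k) *
      ((a - of_nat k) * (1 + s * z) powr (a - of_nat k - 1) * s)"
    by (rule DERIV_imp_deriv) (use Suc.prems in \<open>auto intro!: derivative_eq_intros\<close>)
  also have "\<dots> = s ^ Suc k * (fact k * ((a gchoose k) * (a - of_nat k))) *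
      (1 + s * z) powr (a - of_nat (Suc k))"
    by (simp add: algebra_simps)
  \<comment> \<open>Both sides equal \<open>a * ((a - 1) gchoose k)\<close>, by the two absorption
    identities.\<close>
  also have "(a gchoose k) * (a - of_nat k) = of_nat (Suc k) * (a gchoose Suc k)"
    using gbinomial_absorb_comp[of a k] gbinomial_absorption[of k a]
    by (simp add: mult.commute)
  finally show ?case by (simp add: algebra_simps)
qed

text \<open>With \<open>i\<close> derivatives on the first factor and \<open>n - i\<close> on the
  second, the exponents drop to \<open>\<alpha> + (n - i)\<close> and \<open>\<beta> + i\<close>.
  The powers with exponents \<open>\<alpha>\<close> and \<open>\<beta>\<close> cancel against the
  prefactors of the Rodrigues formula, so only natural powers remain.\<close>

lemma rodrigues_leibniz:
  assumes "z \<in> doubly_cut_plane"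
  shows "rodrigues n \<alpha> \<beta> z =
    (\<Sum>i\<le>n. (\<alpha> + of_nat n gchoose i) * (\<beta> + of_nat n gchoose (n - i)) *
       ((z - 1) / 2) ^ (n - i) * ((z + 1) / 2) ^ i)"
proof -
  note nz = doubly_cut_planeD[OF assms]
  define a b where "a = \<alpha> + of_nat n" and "b = \<beta> + of_nat n"
  have summand: "of_nat (n choose i) * (deriv ^^ i) (\<lambda>w. (1 - w) powr a) z *
        (deriv ^^ (n - i)) (\<lambda>w. (1 + w) powr b) z =
      (-1) ^ n * fact n * (1 - z) powr \<alpha> * (1 + z) powr \<beta> *
        ((a gchoose i) * (b gchoose (n - i)) * (z - 1) ^ (n - i) * (z + 1) ^ i)"
    if "i \<le> n" for i
  proof -
    have p: "(1 - z) powr (a - of_nat i) = (1 - z) powr \<alpha> * (1 - z) ^ (n - i)"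
      and q: "(1 + z) powr (b - of_nat (n - i)) = (1 + z) powr \<beta> * (1 + z) ^ i"
    proof -
      have "a - of_nat i = \<alpha> + of_nat (n - i)" "b - of_nat (n - i) = \<beta> + of_nat i"
        using that by (simp_all add: a_def b_def of_nat_diff)
      thus "(1 - z) powr (a - of_nat i) = (1 - z) powr \<alpha> * (1 - z) ^ (n - i)"
        "(1 + z) powr (b - of_nat (n - i)) = (1 + z) powr \<beta> * (1 + z) ^ i"
        using nz by (simp_all add: powr_add powr_nat')
    qed
    have f: "of_nat (n choose i) * fact i * fact (n - i) = (fact n :: complex)"
      using that by (simp add: binomial_fact)
    \<comment> \<open>Of the \<open>n\<close> signs, \<open>i\<close> come from differentiating
      powers of \<open>1 - w\<close>; the other \<open>n - i\<close> turn \<open>z - 1\<close> into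
      \<open>1 - z\<close>. The full \<open>(-1) ^ n\<close> is wanted because it cancels the sign
      in the Rodrigues formula.\<close>
    have "(-1) ^ n * (z - 1) ^ (n - i) = (-1) ^ i * ((-1) * (z - 1)) ^ (n - i)"
      using that unfolding power_mult_distrib
      by (simp flip: mult.assoc power_add)
    hence s: "(-1) ^ n * (z - 1) ^ (n - i) = (-1) ^ i * (1 - z) ^ (n - i)" by simp
    have "of_nat (n choose i) * (deriv ^^ i) (\<lambda>w. (1 - w) powr a) z *
        (deriv ^^ (n - i)) (\<lambda>w. (1 + w) powr b) z =
      of_nat (n choose i) * ((-1) ^ i * fact i * (a gchoose i) * (1 - z) powr (a - of_nat i)) *
        (fact (n - i) * (b gchoose (n - i)) * (1 + z) powr (b - of_nat (n - i)))"
      using higher_deriv_powr_affine[of "-1" z i a] higher_deriv_powr_affine[of 1 z "n - i" b] nz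
      by simp
    also have "\<dots> = (of_nat (n choose i) * fact i * fact (n - i)) * (1 - z) powr \<alpha> * (1 + z) powr \<beta> *
        ((a gchoose i) * (b gchoose (n - i)) * ((-1) ^ i * (1 - z) ^ (n - i)) * (1 + z) ^ i)"
      unfolding p q by (simp only: mult_ac)
    finally show ?thesis unfolding f s[symmetric] by (simp add: mult_ac add.commute)
  qed
  have "(deriv ^^ n) (\<lambda>w. (1 - w) powr a * (1 + w) powr b) z =
      (\<Sum>i = 0..n. of_nat (n choose i) * (deriv ^^ i) (\<lambda>w. (1 - w) powr a) z *
        (deriv ^^ (n - i)) (\<lambda>w. (1 + w) powr b) z)"
    by (rule higher_deriv_mult[OF _ _ open_doubly_cut_plane assms])
       (auto intro!: holomorphic_intros dest: doubly_cut_planeD)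
  also have "\<dots> = (-1) ^ n * fact n * (1 - z) powr \<alpha> * (1 + z) powr \<beta> *
     (\<Sum>i\<le>n. (a gchoose i) * (b gchoose (n - i)) * (z - 1) ^ (n - i) * (z + 1) ^ i)"
    unfolding sum_distrib_left atMost_atLeast0 by (rule sum.cong) (simp_all add: summand)
  finally have "rodrigues n \<alpha> \<beta> z =
      (\<Sum>i\<le>n. (a gchoose i) * (b gchoose (n - i)) * (z - 1) ^ (n - i) * (z + 1) ^ i) / 2 ^ n"
    unfolding rodrigues_def a_def b_def using nz
    by (simp add: powr_minus field_simps flip: power_mult_distrib)
  also have "\<dots> = (\<Sum>i\<le>n. (a gchoose i) * (b gchoose (n - i)) *
      ((z - 1) / 2) ^ (n - i) * ((z + 1) / 2) ^ i)"
    unfolding sum_divide_distrib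
    by (rule sum.cong) (simp_all add: power_divide flip: power_add)
  finally show ?thesis by (simp add: a_def b_def)
qed

text \<open>Here \<open>t\<close> stands for (z - 1)/2, so that \<open>1 + t\<close> is (z + 1)/2.
  Expanding \<open>(1 + t) ^ i\<close> and revising \<open>(a gchoose i) * (i gchoose l)\<close> to
  \<open>(a gchoose l) * (a - l gchoose (i - l))\<close> leaves the power
  \<open>t ^ (n - l)\<close>, which is free of \<open>i\<close>; the sum over \<open>i\<close> is
  then a Vandermonde convolution.\<close>

lemma jacobi_sum_eq_hypergeometric:
  fixes a b t :: "'a :: field_char_0"
  shows "(\<Sum>i\<le>n. (a gchoose i) * (b gchoose (n - i)) * t ^ (n - i) * (1 + t) ^ i) =
    (\<Sum>j\<le>n. (a gchoose (n - j)) * (a + b - of_nat (n - j) gchoose j) * t ^ j)"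
proof -
  have "(\<Sum>i\<le>n. (a gchoose i) * (b gchoose (n - i)) * t ^ (n - i) * (1 + t) ^ i) =
      (\<Sum>i\<le>n. \<Sum>l\<le>i. (a gchoose l) * t ^ (n - l) *
         ((a - of_nat l gchoose (i - l)) * (b gchoose (n - i))))"
  proof (rule sum.cong[OF refl])
    fix i assume "i \<in> {..n}"
    have "(a gchoose i) * (b gchoose (n - i)) * t ^ (n - i) * (1 + t) ^ i =
       (\<Sum>l\<le>i. ((a gchoose i) * (of_nat i gchoose l)) * (b gchoose (n - i)) *
         (t ^ (n - i) * t ^ (i - l)))"
      by (simp add: binomial_ring sum_distrib_left binomial_gbinomial mult_ac)
    also have "\<dots> = (\<Sum>l\<le>i. (a gchoose l) * t ^ (n - l) *
         ((a - of_nat l gchoose (i - l)) * (b gchoose (n - i))))"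
      using \<open>i \<in> {..n}\<close>
      by (intro sum.cong refl)
         (simp add: gbinomial_trinomial_revision mult_ac flip: power_add)
    finally show "(a gchoose i) * (b gchoose (n - i)) * t ^ (n - i) * (1 + t) ^ i = \<dots>" .
  qed
  \<comment> \<open>The double sum runs over l \<le> i \<le> n, and its order is exchanged.\<close>
  also have "\<dots> = (\<Sum>l\<le>n. (a gchoose l) * t ^ (n - l) *
      (\<Sum>i=l..n. (a - of_nat l gchoose (i - l)) * (b gchoose (n - i))))"
    unfolding sum_distrib_left
    by (subst (1 2) sum.Sigma)
       (auto intro!: sum.reindex_bij_witness[of _ prod.swap prod.swap])
  also have "\<dots> = (\<Sum>l\<le>n. (a gchoose l) * (a + b - of_nat l gchoose (n - l)) * t ^ (n - l))"
  proof (rule sum.cong[OF refl])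
    fix l assume l: "l \<in> {..n}"
    have "(\<Sum>i=l..n. (a - of_nat l gchoose (i - l)) * (b gchoose (n - i))) =
        (\<Sum>k=0..n-l. (a - of_nat l gchoose k) * (b gchoose (n - l - k)))"
      using l by (intro sum.reindex_bij_witness[of _ "\<lambda>k. k + l" "\<lambda>i. i - l"]) auto
    also have "\<dots> = (a + b - of_nat l gchoose (n - l))"
      unfolding gbinomial_Vandermonde by (simp only: diff_add_eq)
    finally show "(a gchoose l) * t ^ (n - l) *
        (\<Sum>i=l..n. (a - of_nat l gchoose (i - l)) * (b gchoose (n - i))) =
      (a gchoose l) * (a + b - of_nat l gchoose (n - l)) * t ^ (n - l)"
      by simp
  qed
  also have "\<dots> = (\<Sum>j\<le>n. (a gchoose (n - j)) * (a + b - of_nat (n - j) gchoose j) * t ^ j)"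
    by (intro sum.reindex_bij_witness[of _ "\<lambda>j. n - j" "\<lambda>l. n - l"]) auto
  finally show ?thesis .
qed

lemma infinite_doubly_cut_plane: "infinite doubly_cut_plane"
proof -
  have "0 \<in> doubly_cut_plane" by (simp add: doubly_cut_plane_def)
  thus ?thesis using finite_imp_not_open[of doubly_cut_plane] open_doubly_cut_plane by blast
qed

text \<open>The Rodrigues formula gives this only off the cuts. Both sides are polynomials agreeing
  on an infinite set, so the identity extends to every \<open>z\<close>, in particular to the points
  z > 1 on the cut where the Legendre function lives.\<close>

lemma jacobi_eq_sum:
  "jacobi n \<alpha> \<beta> z =
    (\<Sum>j\<le>n. (\<alpha> + of_nat n gchoose (n - j)) * (\<alpha> + \<beta> + of_nat (n + j) gchoose j) * ((z - 1) / 2) ^ j)"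
proof -
  define p where "p = (\<Sum>j\<le>n. smult ((\<alpha> + of_nat n gchoose (n - j)) *
    (\<alpha> + \<beta> + of_nat (n + j) gchoose j)) ([:- 1 / 2, 1 / 2:] ^ j))"
  have p: "poly p w = (\<Sum>j\<le>n. (\<alpha> + of_nat n gchoose (n - j)) *
      (\<alpha> + \<beta> + of_nat (n + j) gchoose j) * ((w - 1) / 2) ^ j)" for w
    by (simp add: p_def poly_sum diff_divide_distrib)
  have eq: "poly p w = jacobi n \<alpha> \<beta> w" if "w \<in> doubly_cut_plane" for w
  proof -
    have "1 + (w - 1) / 2 = (w + 1) / 2" by (simp add: field_simps)
    hence "jacobi n \<alpha> \<beta> w = (\<Sum>i\<le>n. (\<alpha> + of_nat n gchoose i) * (\<beta> + of_nat n gchoose (n - i)) *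
       ((w - 1) / 2) ^ (n - i) * (1 + (w - 1) / 2) ^ i)"
      by (simp only: jacobi_rodrigues[OF that] rodrigues_leibniz[OF that])
    also have "\<dots> = poly p w"
      unfolding jacobi_sum_eq_hypergeometric p
      by (intro sum.cong refl) (simp add: of_nat_diff algebra_simps)
    finally show ?thesis by simp
  qed
  have "doubly_cut_plane \<subseteq> {w. poly (p - jacobi_poly n \<alpha> \<beta>) w = 0}"
    using eq by (auto simp: jacobi_def)
  hence "infinite {w. poly (p - jacobi_poly n \<alpha> \<beta>) w = 0}"
    using infinite_doubly_cut_plane finite_subset by blast
  hence "p = jacobi_poly n \<alpha> \<beta>"
    using poly_roots_finite[of "p - jacobi_poly n \<alpha> \<beta>"] by auto
  thus ?thesis using p[of z] by (simp add: jacobi_def)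
qed

section \<open>The terminating Gauss series and the Legendre function\<close>

lemma hyp2F1_terminating:
  assumes "x \<in> slit_plane"
  shows "hyp2F1 (- of_nat n) b c x =
    (\<Sum>k\<le>n. pochhammer (- of_nat n) k * pochhammer b k / (pochhammer c k * fact k) * x ^ k)"
proof (rule hyp2F1_unique[OF _ _ assms])
  show "(\<lambda>x. \<Sum>k\<le>n. pochhammer (- of_nat n) k * pochhammer b k / (pochhammer c k * fact k) * x ^ k)
      holomorphic_on slit_plane"
    by (intro holomorphic_intros)
       (auto simp: divide_inverse intro!: holomorphic_intros)
  fix w :: complex
  \<comment> \<open>The series stops at \<open>k = n\<close>, so its sum is a polynomial and is its
    own continuation to the slit plane. The continuation matters for z \<ge> 3, where (1 - z)/2 lies
    outside the unit disc.\<close>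
  have "pochhammer (- of_nat n :: complex) k = 0" if "k \<notin> {..n}" for k
    using that by (simp add: pochhammer_of_nat_eq_0_iff)
  thus "(\<Sum>k\<le>n. pochhammer (- of_nat n) k * pochhammer b k / (pochhammer c k * fact k) * w ^ k) =
      eval_fps (fps_hypergeo [- of_nat n, b] [c] 1) w"
    unfolding eval_fps_def by (subst suminf_finite[of "{..n}"]) auto
qed

text \<open>This unifies the two signs: for \<nu> = n the numerator parameters are -n and n + 1, and
  for \<nu> = -n - 1 they are the same pair in reverse order.\<close>

lemma hyp2F1_swap: "hyp2F1 a b c x = hyp2F1 b a c x"
proof -
  have "fps_hypergeo [a, b] [c] 1 = fps_hypergeo [b, a] [c] 1"
    by (simp add: fps_eq_iff mult.commute)
  thus ?thesis by (simp add: hyp2F1_def)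
qed

text \<open>The form of the Legendre function of degree n or - n - 1 that is continuous in \<mu>.\<close>

definition legendre_P_regular :: "nat \<Rightarrow> complex \<Rightarrow> real \<Rightarrow> complex" where
  "legendre_P_regular n \<mu> z = of_real ((z + 1) / (z - 1)) powr (\<mu> / 2) *
     (\<Sum>k\<le>n. fact k * of_nat (n choose k) * of_nat (n + k choose k) *
        rGamma (1 - \<mu> + of_nat k) * of_real ((z - 1) / 2) ^ k)"

text \<open>Away from the poles no \<open>pochhammer (1 - \<mu>) k\<close> vanishes, so each one
  cancels against \<open>rGamma (1 - \<mu>)\<close> and leaves
  \<open>rGamma (1 - \<mu> + k)\<close>. The numerator symbols become factorials times binomial
  coefficients, and the sign of the first turns (1 - z)/2 into (z - 1)/2.\<close>

lemma legendre_P_generic_eq_regular: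
  assumes "\<nu> = of_nat n \<or> \<nu> = - of_nat n - 1" "z > 1" "1 - \<mu> \<notin> \<int>\<^sub>\<le>\<^sub>0"
  shows "legendre_P_generic \<nu> \<mu> z = legendre_P_regular n \<mu> z"
proof -
  define x where "x = complex_of_real ((1 - z) / 2)"
  have "x \<in> slit_plane" using assms by (simp add: x_def slit_plane_def)
  have "hyp2F1 (- \<nu>) (\<nu> + 1) (1 - \<mu>) x = hyp2F1 (- of_nat n) (of_nat n + 1) (1 - \<mu>) x"
    using assms(1) hyp2F1_swap[of "of_nat n + 1" "- of_nat n"] by (auto simp: add.commute)
  also have "\<dots> = (\<Sum>k\<le>n. pochhammer (- of_nat n) k * pochhammer (of_nat n + 1) k /
      (pochhammer (1 - \<mu>) k * fact k) * x ^ k)"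
    by (rule hyp2F1_terminating) fact
  finally have h: "rGamma (1 - \<mu>) * hyp2F1 (- \<nu>) (\<nu> + 1) (1 - \<mu>) x =
      (\<Sum>k\<le>n. rGamma (1 - \<mu>) * (pochhammer (- of_nat n) k * pochhammer (of_nat n + 1) k /
      (pochhammer (1 - \<mu>) k * fact k) * x ^ k))"
    by (simp add: sum_distrib_left)
  also have "\<dots> = (\<Sum>k\<le>n. fact k * of_nat (n choose k) * of_nat (n + k choose k) *
        rGamma (1 - \<mu> + of_nat k) * of_real ((z - 1) / 2) ^ k)"
  proof (rule sum.cong[OF refl])
    fix k
    have nz: "pochhammer (1 - \<mu>) k \<noteq> 0"
      using assms(3) by (auto simp: pochhammer_eq_0_iff)
    have g: "rGamma (1 - \<mu>) = pochhammer (1 - \<mu>) k * rGamma (1 - \<mu> + of_nat k)"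
      by (rule pochhammer_rGamma)
    have c1: "pochhammer (- of_nat n) k = (-1) ^ k * fact k * complex_of_nat (n choose k)"
      by (simp add: binomial_gbinomial gbinomial_pochhammer flip: mult.assoc power_mult_distrib)
    have c2: "pochhammer (of_nat n + 1) k = fact k * complex_of_nat (n + k choose k)"
      by (simp add: binomial_gbinomial gbinomial_pochhammer')
    have "x = - of_real ((z - 1) / 2)" by (simp add: x_def field_simps)
    hence s: "(-1) ^ k * x ^ k = of_real ((z - 1) / 2) ^ k"
      by (metis mult_minus1 minus_minus power_mult_distrib)
    have "rGamma (1 - \<mu>) * (pochhammer (- of_nat n) k * pochhammer (of_nat n + 1) k /
        (pochhammer (1 - \<mu>) k * fact k) * x ^ k) =
      fact k * of_nat (n choose k) * of_nat (n + k choose k) *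
        rGamma (1 - \<mu> + of_nat k) * ((-1) ^ k * x ^ k)"
      unfolding g c1 c2 using nz by (simp add: field_simps)
    thus "rGamma (1 - \<mu>) * (pochhammer (- of_nat n) k * pochhammer (of_nat n + 1) k /
        (pochhammer (1 - \<mu>) k * fact k) * x ^ k) =
      fact k * of_nat (n choose k) * of_nat (n + k choose k) *
        rGamma (1 - \<mu> + of_nat k) * of_real ((z - 1) / 2) ^ k"
      unfolding s .
  qed
  finally have "legendre_P_regular n \<mu> z = of_real ((z + 1) / (z - 1)) powr (\<mu> / 2) *
      (rGamma (1 - \<mu>) * hyp2F1 (- \<nu>) (\<nu> + 1) (1 - \<mu>) x)"
    by (simp only: legendre_P_regular_def)
  thus ?thesis
    by (simp only: legendre_P_generic_def x_def rGamma_inverse_Gamma inverse_eq_divide mult_ac)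
qed

lemma legendre_P_eq_regular:
  assumes "\<nu> = of_nat n \<or> \<nu> = - of_nat n - 1" "z > 1"
  shows "legendre_P \<nu> \<mu> z = legendre_P_regular n \<mu> z"
proof (cases "1 - \<mu> \<in> \<int>\<^sub>\<le>\<^sub>0")
  case False
  moreover have "\<not> (\<exists>m::nat. m \<ge> 1 \<and> \<mu> = of_nat m)"
  proof
    assume "\<exists>m::nat. m \<ge> 1 \<and> \<mu> = of_nat m"
    then obtain m :: nat where "m \<ge> 1" "\<mu> = of_nat m" by blast
    hence "1 - \<mu> = - of_nat (m - 1)" by (simp add: of_nat_diff)
    thus False using False by (metis minus_of_nat_in_nonpos_Ints)
  qed
  ultimately show ?thesis
    using legendre_P_generic_eq_regular[OF assms] by (simp only: legendre_P_def if_False)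
next
  case True
  then obtain k :: nat where "1 - \<mu> = - of_nat k" by (elim nonpos_Ints_cases')
  hence \<mu>: "\<mu> = of_nat (Suc k)" by (simp add: algebra_simps)
  \<comment> \<open>Distinct integers are at distance at least 1, so this punctured disc around the
    integer \<mu> contains no other integer and the generic formula is valid on it.\<close>
  have "eventually (\<lambda>\<kappa>. \<kappa> \<in> ball \<mu> 1 - {\<mu>}) (at \<mu>)"
    by (rule eventually_at_in_open) auto
  hence ev: "eventually (\<lambda>\<kappa>. legendre_P_regular n \<kappa> z = legendre_P_generic \<nu> \<kappa> z) (at \<mu>)"
  proof (rule eventually_mono)
    fix \<kappa> assume \<kappa>: "\<kappa> \<in> ball \<mu> 1 - {\<mu>}"
    have "1 - \<kappa> \<notin> \<int>\<^sub>\<le>\<^sub>0"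
    proof
      assume "1 - \<kappa> \<in> \<int>\<^sub>\<le>\<^sub>0"
      then obtain l :: nat where "1 - \<kappa> = - of_nat l" by (elim nonpos_Ints_cases')
      hence "\<kappa> = of_nat (Suc l)" by (simp add: algebra_simps)
      hence "\<mu> - \<kappa> = of_int (int k - int l)" using \<mu> by simp
      hence "norm (\<mu> - \<kappa>) = real_of_int \<bar>int k - int l\<bar>"
        by (simp only: norm_of_int of_int_abs)
      hence "real_of_int \<bar>int k - int l\<bar> < 1" using \<kappa> by (simp add: dist_norm)
      hence "k = l" by linarith
      thus False using \<kappa> \<mu> \<open>\<kappa> = of_nat (Suc l)\<close> by simp
    qed
    thus "legendre_P_regular n \<kappa> z = legendre_P_generic \<nu> \<kappa> z"
      using legendre_P_generic_eq_regular[OF assms] by simp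
  qed
  have "isCont (\<lambda>\<kappa>. legendre_P_regular n \<kappa> z) \<mu>"
  proof -
    \<comment> \<open>A nonzero base selects the exponential branch of \<open>powr\<close>, which is
      continuous in the exponent; \<open>rGamma\<close> is entire.\<close>
    have "complex_of_real ((z + 1) / (z - 1)) \<noteq> 0" using assms by (subst of_real_eq_0_iff) simp
    thus ?thesis
      unfolding legendre_P_regular_def powr_def
      by (simp only: if_False) (intro isCont_mult isCont_sum isCont_rGamma isCont_exp' isCont_add
          isCont_diff isCont_divide continuous_const continuous_ident ballI; simp)
  qed
  hence "((\<lambda>\<kappa>. legendre_P_regular n \<kappa> z) \<longlongrightarrow> legendre_P_regular n \<mu> z) (at \<mu>)"
    by (simp add: isCont_def)
  hence "((\<lambda>\<kappa>. legendre_P_generic \<nu> \<kappa> z) \<longlongrightarrow> legendre_P_regular n \<mu> z) (at \<mu>)"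
    using ev by (rule Lim_transform_eventually)
  hence "Lim (at \<mu>) (\<lambda>\<kappa>. legendre_P_generic \<nu> \<kappa> z) = legendre_P_regular n \<mu> z"
    by (intro tendsto_Lim) auto
  moreover have "\<exists>m::nat. m \<ge> 1 \<and> \<mu> = of_nat m" using \<mu> by (intro exI[of _ "Suc k"]) simp
  ultimately show ?thesis by (simp add: legendre_P_def)
qed

section \<open>Comparison of coefficients and the final formulas\<close>

lemma legendre_P_regular_eq_jacobi:
  "legendre_P_regular n \<mu> z = fact n / Gamma (of_nat n - \<mu> + 1) *
     of_real ((z + 1) / (z - 1)) powr (\<mu> / 2) * jacobi n (- \<mu>) \<mu> (of_real z)"
proof -
  have "fact k * of_nat (n choose k) * of_nat (n + k choose k) * rGamma (1 - \<mu> + of_nat k) =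
      fact n * rGamma (of_nat n - \<mu> + 1) *
       ((- \<mu> + of_nat n gchoose (n - k)) * (- \<mu> + \<mu> + of_nat (n + k) gchoose k))"
    if "k \<le> n" for k
  proof -
    \<comment> \<open>Raising every argument to \<open>n - \<mu> + 1\<close> extracts the common
      Gamma factor. The Pochhammer symbol left over is the first binomial factor of the Jacobi
      coefficient times (n - k)!; the second factor is an ordinary binomial coefficient because
      \<alpha> + \<beta> = 0.\<close>
    have "rGamma (1 - \<mu> + of_nat k) =
        pochhammer (1 - \<mu> + of_nat k) (n - k) * rGamma (of_nat n - \<mu> + 1)"
      using pochhammer_rGamma[of "1 - \<mu> + of_nat k" "n - k"] that
      by (simp add: of_nat_diff algebra_simps)
    moreover have "pochhammer (1 - \<mu> + of_nat k) (n - k) =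
        fact (n - k) * (- \<mu> + of_nat n gchoose (n - k))"
      using that by (simp add: gbinomial_pochhammer' of_nat_diff algebra_simps)
    moreover have "fact k * of_nat (n choose k) * fact (n - k) = (fact n :: complex)"
      using that by (simp add: binomial_fact)
    moreover have "(- \<mu> + \<mu> + of_nat (n + k) gchoose k) = of_nat (n + k choose k)"
      by (simp add: binomial_gbinomial)
    ultimately show ?thesis by (simp add: mult_ac)
  qed
  hence "(\<Sum>k\<le>n. fact k * of_nat (n choose k) * of_nat (n + k choose k) *
        rGamma (1 - \<mu> + of_nat k) * of_real ((z - 1) / 2) ^ k) =
      fact n * rGamma (of_nat n - \<mu> + 1) * jacobi n (- \<mu>) \<mu> (of_real z)"
    unfolding jacobi_eq_sum sum_distrib_left
    by (intro sum.cong refl) (simp add: mult.assoc)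
  hence "legendre_P_regular n \<mu> z = of_real ((z + 1) / (z - 1)) powr (\<mu> / 2) *
      (fact n * rGamma (of_nat n - \<mu> + 1) * jacobi n (- \<mu>) \<mu> (of_real z))"
    by (simp only: legendre_P_regular_def)
  \<comment> \<open>This is valid at the poles too: there \<open>Gamma\<close> takes the default
    value 0, and its inverse 0 is the true value of \<open>rGamma\<close>.\<close>
  thus ?thesis by (simp only: rGamma_inverse_Gamma divide_inverse mult_ac)
qed

lemma half_angle_coth_square:
  assumes "\<xi> > 0"
  shows "(cosh \<xi> + 1) / (cosh \<xi> - 1) = (coth (\<xi> / 2))\<^sup>2"
proof -
  have "cosh \<xi> = 2 * cosh (\<xi> / 2) ^ 2 - 1" "cosh \<xi> = 2 * sinh (\<xi> / 2) ^ 2 + 1"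
    using cosh_double_cosh[of "\<xi> / 2"] cosh_double[of "\<xi> / 2"]
      cosh_square_eq[of "\<xi> / 2"] by simp_all
  hence "cosh \<xi> + 1 = 2 * cosh (\<xi> / 2) ^ 2" "cosh \<xi> - 1 = 2 * sinh (\<xi> / 2) ^ 2"
    by linarith+
  thus ?thesis by (simp only: coth_def) (simp add: power_divide)
qed

theorem theorem8p1:
  fixes n :: nat and \<mu> \<nu> :: complex
  assumes "\<nu> = - 1 / 2 + (of_nat n + 1 / 2) \<or> \<nu> = - 1 / 2 - (of_nat n + 1 / 2)"
  shows "(\<forall>z::real. 1 < z \<longrightarrow>
            legendre_P \<nu> \<mu> z =
              fact n / Gamma (of_nat n - \<mu> + 1) * of_real ((z + 1) / (z - 1)) powr (\<mu> / 2) *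
                jacobi n (- \<mu>) \<mu> (of_real z)) \<and>
         (\<forall>\<xi>::real. 0 < \<xi> \<longrightarrow>
            legendre_P \<nu> \<mu> (cosh \<xi>) =
              fact n / Gamma (of_nat n - \<mu> + 1) * of_real (coth (\<xi> / 2)) powr \<mu> *
                jacobi n (- \<mu>) \<mu> (of_real (cosh \<xi>))) \<and>
         ((\<exists>m::nat. m \<ge> 1 \<and> \<mu> - of_nat n = of_nat m) \<longrightarrow>
            (\<forall>z::real. 1 < z \<longrightarrow> legendre_P \<nu> \<mu> z = 0))"
proof -
  have \<nu>: "\<nu> = of_nat n \<or> \<nu> = - of_nat n - 1"
    using assms by (auto simp: add_divide_distrib)
  have main: "legendre_P \<nu> \<mu> z =
      fact n / Gamma (of_nat n - \<mu> + 1) * of_real ((z + 1) / (z - 1)) powr (\<mu> / 2) *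
        jacobi n (- \<mu>) \<mu> (of_real z)" if "z > 1" for z :: real
    using legendre_P_eq_regular[OF \<nu> that] legendre_P_regular_eq_jacobi by simp
  have "legendre_P \<nu> \<mu> (cosh \<xi>) =
      fact n / Gamma (of_nat n - \<mu> + 1) * of_real (coth (\<xi> / 2)) powr \<mu> *
        jacobi n (- \<mu>) \<mu> (of_real (cosh \<xi>))" if "\<xi> > 0" for \<xi> :: real
  proof -
    have pos: "coth (\<xi> / 2) > 0" using that by (simp add: coth_def)
    have "cosh \<xi> > 1" using cosh_real_strict_mono[of 0 \<xi>] that by simp
    \<comment> \<open>Since \<open>coth (\<xi> / 2)\<close> is positive, the principal logarithms
      are real, and the logarithm of the square is exactly twice that of the base; this absorbs the
      1/2 in the exponent.\<close>
    have "complex_of_real ((coth (\<xi> / 2))\<^sup>2) powr (\<mu> / 2) =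
        exp (\<mu> / 2 * of_real (ln ((coth (\<xi> / 2))\<^sup>2)))"
      using pos by (simp add: powr_def Ln_of_real del: of_real_power)
    also have "\<dots> = of_real (coth (\<xi> / 2)) powr \<mu>"
      using pos by (simp add: powr_def Ln_of_real ln_realpow)
    finally show ?thesis
      using main[OF \<open>cosh \<xi> > 1\<close>] half_angle_coth_square[OF that] by simp
  qed
  moreover have "legendre_P \<nu> \<mu> z = 0" if "m \<ge> 1" "\<mu> - of_nat n = of_nat m" "z > 1" for m z
  proof -
    \<comment> \<open>The bound m \<ge> 1 makes the natural subtraction exact, so this is a pole of
      Gamma. Division by the default value 0 then makes the prefactor vanish, as 1/Gamma does
      there.\<close>
    have "of_nat n - \<mu> + 1 = - complex_of_nat (m - 1)"
      using that by (simp add: of_nat_diff algebra_simps)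
    hence "Gamma (of_nat n - \<mu> + 1) = 0"
      by (metis Gamma_eq_zero_iff minus_of_nat_in_nonpos_Ints)
    thus ?thesis using main[OF \<open>z > 1\<close>] by simp
  qed
  ultimately show ?thesis using main by blast
qed

end
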